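(* Let $A$ be a skew left brace. Then: (1) $\mathrm{Z}(\Lambda_{A^{\mathrm{op}}})\trianglelefteq \mathrm{Fix}(\lambda^{\mathrm{op}})\rtimes_{\lambda^{\mathrm{op}}}\mathrm{Z}(A,\circ)\cong \mathrm{Fix}(\lambda^{\mathrm{op}})\times \mathrm{Z}(A,\circ)$. (2) If $(x,y)\in \mathrm{Z}(\Lambda_{A^{\mathrm{op}}})$, then $\lambda_y(a)=y^{-1}x^{-1}axy$ and $\lambda_a(y)=a^{-1}x^{-1}axy$ for all $a\in A$. (3) For $x\in A$, $(x,1)\in \mathrm{Z}(\Lambda_{A^{\mathrm{op}}})$ if and only if $x\in \mathrm{Z}(A,\cdot)\cap\mathrm{Fix}(\lambda)$. (4) For $y\in A$, $(1,y)\in \mathrm{Z}(\Lambda_{A^{\mathrm{op}}})$ if and only if $y\in \mathrm{Z}(A,\circ)\cap\mathrm{Fix}(\lambda)\cap\mathrm{Ker}(\lambda^{\mathrm{op}})$. (5) $\mathrm{Ann}(A)\times\mathrm{Ann}(A)\trianglelefteq \mathrm{Z}(\Lambda_{A^{\mathrm{op}}})$.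
   Context: A skew left brace is a triple $(A,\cdot,\circ)$ where $(A,\cdot)$ and $(A,\circ)$ are groups with $a\circ(b\cdot c)=(a\circ b)\cdot a^{-1}\cdot(a\circ c)$ for all $a,b,c\in A$, where $a^{-1}$ is the inverse in $(A,\cdot)$. We write $ab=a\cdot b$; the two groups share the identity $1$. The map $\lambda:(A,\circ)\to\mathrm{Aut}(A,\cdot)$, $\lambda_a(b)=a^{-1}(a\circ b)$, is a group homomorphism, and so is $\lambda^{\mathrm{op}}:(A,\circ)\to\mathrm{Aut}(A,\cdot)$, $\lambda^{\mathrm{op}}_a(b)=(a\circ b)a^{-1}=a\lambda_a(b)a^{-1}$. The group $\Lambda_{A^{\mathrm{op}}}=(A,\cdot)\rtimes_{\lambda^{\mathrm{op}}}(A,\circ)$ is the set $A\times A$ with product $(a_1,b_1)(a_2,b_2)=(a_1\lambda^{\mathrm{op}}_{b_1}(a_2),\,b_1\circ b_2)$. $\mathrm{Z}(G)$ denotes the center of a group. $\mathrm{Fix}(\lambda)=\{x\in A\mid \lambda_a(x)=x \text{ for all } a\in A\}$ and $\mathrm{Fix}(\lambda^{\mathrm{op}})=\{x\in A\mid \lambda^{\mathrm{op}}_a(x)=x \text{ for all } a\in A\}$, regarded as subgroups of $(A,\cdot)$. $\mathrm{Ann}(A)=\mathrm{Ker}(\lambda)\cap\mathrm{Z}(A,\cdot)\cap\mathrm{Z}(A,\circ)$. For subsets $S,T\subseteq A$, the groups $S\rtimes_{\lambda^{\mathrm{op}}}T$ and $S\times T$ above, when compared with $\mathrm{Z}(\Lambda_{A^{\mathrm{op}}})$,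 are the subgroups of $\Lambda_{A^{\mathrm{op}}}$ with underlying set $\{(s,t)\mid s\in S,t\in T\}$. $N\trianglelefteq G$ means $N$ is a normal subgroup of $G$. *)

theory Defs
  imports "HOL-Algebra.Algebra"
begin

text \<open>
  A skew left brace on a set \<open>A\<close> is given by its two groups \<open>G\<close>, standing for \<open>(A, \<cdot>)\<close>, and
  \<open>H\<close>, standing for \<open>(A, \<circ>)\<close>, on the common carrier \<open>A\<close>. That the identities of \<open>G\<close> and \<open>H\<close>
  coincide is a consequence of the axioms.
\<close>

locale skew_left_brace = dot: group G + circ: group H
  for G :: "('a, 'm) monoid_scheme" (structure) and H :: "('a, 'n) monoid_scheme" +
  assumes carrier_eq: "carrier H = carrier G"
    and brace_compat: "\<lbrakk>a \<in> carrier G; b \<in> carrier G; c \<in> carrier G\<rbrakk> \<Longrightarrow>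
      a \<otimes>\<^bsub>H\<^esub> (b \<otimes> c) = (a \<otimes>\<^bsub>H\<^esub> b) \<otimes> inv a \<otimes> (a \<otimes>\<^bsub>H\<^esub> c)"

text \<open>
  The maps \<open>\<lambda>\<^sub>a\<close> and \<open>\<lambda>\<^sup>o\<^sup>p\<^sub>a\<close> are restricted to the carrier because the elements of \<^const>\<open>AutoGroup\<close>
  are extensional functions.
\<close>

definition brace_lambda ::
    "('a, 'm) monoid_scheme \<Rightarrow> ('a, 'n) monoid_scheme \<Rightarrow> 'a \<Rightarrow> 'a \<Rightarrow> 'a" where
  "brace_lambda G H a = (\<lambda>b\<in>carrier G. inv\<^bsub>G\<^esub> a \<otimes>\<^bsub>G\<^esub> (a \<otimes>\<^bsub>H\<^esub> b))"

definition brace_lambda_op ::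
    "('a, 'm) monoid_scheme \<Rightarrow> ('a, 'n) monoid_scheme \<Rightarrow> 'a \<Rightarrow> 'a \<Rightarrow> 'a" where
  "brace_lambda_op G H a = (\<lambda>b\<in>carrier G. (a \<otimes>\<^bsub>H\<^esub> b) \<otimes>\<^bsub>G\<^esub> inv\<^bsub>G\<^esub> a)"

definition group_center :: "('a, 'm) monoid_scheme \<Rightarrow> 'a set" where
  "group_center G = {z \<in> carrier G. \<forall>g \<in> carrier G. z \<otimes>\<^bsub>G\<^esub> g = g \<otimes>\<^bsub>G\<^esub> z}"

definition action_Fix ::
    "('a, 'm) monoid_scheme \<Rightarrow> ('b, 'n) monoid_scheme \<Rightarrow> ('b \<Rightarrow> 'a \<Rightarrow> 'a) \<Rightarrow> 'a set" where
  "action_Fix G H \<phi> = {x \<in> carrier G. \<forall>a \<in> carrier H. \<phi> a x = x}"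

definition semidirect ::
    "('a, 'm) monoid_scheme \<Rightarrow> ('b, 'n) monoid_scheme \<Rightarrow> ('b \<Rightarrow> 'a \<Rightarrow> 'a) \<Rightarrow> ('a \<times> 'b) monoid" where
  "semidirect G H \<phi> =
    \<lparr>carrier = carrier G \<times> carrier H,
     monoid.mult = (\<lambda>(a\<^sub>1, b\<^sub>1) (a\<^sub>2, b\<^sub>2). (a\<^sub>1 \<otimes>\<^bsub>G\<^esub> \<phi> b\<^sub>1 a\<^sub>2, b\<^sub>1 \<otimes>\<^bsub>H\<^esub> b\<^sub>2)),
     monoid.one = (\<one>\<^bsub>G\<^esub>, \<one>\<^bsub>H\<^esub>)\<rparr>"

lemma semidirect_restrict_carrier:
  "semidirect (G\<lparr>carrier := S\<rparr>) (H\<lparr>carrier := T\<rparr>) \<phi> = (semidirect G H \<phi>)\<lparr>carrier := S \<times> T\<rparr>"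
  by (simp add: semidirect_def)

definition Lambda_op ::
    "('a, 'm) monoid_scheme \<Rightarrow> ('a, 'n) monoid_scheme \<Rightarrow> ('a \<times> 'a) monoid" where
  "Lambda_op G H = semidirect G H (brace_lambda_op G H)"

definition brace_Ann :: "('a, 'm) monoid_scheme \<Rightarrow> ('a, 'n) monoid_scheme \<Rightarrow> 'a set" where
  "brace_Ann G H =
    kernel H (AutoGroup G) (brace_lambda G H) \<inter> group_center G \<inter> group_center H"

end

theory Submission
  imports Defs
begin

text \<open>
  Comparing \<open>(x, y)(1, b)\<close> with \<open>(1, b)(x, y)\<close> and \<open>(x, y)(a, 1)\<close> with \<open>(a, 1)(x, y)\<close> shows that
  \<open>(x, y)\<close> is central in a semidirect product \<open>G \<rtimes>\<^sub>\<phi> H\<close> iff \<open>x\<close> is fixed by the action, \<open>y\<close> is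
  central in \<open>H\<close>, and \<open>x \<phi>\<^sub>y(a) = a x\<close> for all \<open>a\<close>. For \<open>\<phi> = \<lambda>\<^sup>o\<^sup>p\<close> the last condition reads
  \<open>y \<circ> a = x\<^sup>-\<^sup>1 a x y\<close>.
\<close>

section \<open>Centers, central subgroups and kernels of actions\<close>

lemma group_centerD:
  assumes "z \<in> group_center G"
  shows "z \<in> carrier G" and "\<And>g. g \<in> carrier G \<Longrightarrow> z \<otimes>\<^bsub>G\<^esub> g = g \<otimes>\<^bsub>G\<^esub> z"
  using assms by (auto simp: group_center_def)

lemma (in group) subgroup_group_center: "subgroup (group_center G) G"
proof (rule subgroupI)
  show "group_center G \<subseteq> carrier G" "group_center G \<noteq> {}"
    by (auto simp: group_center_def)
  show "inv a \<in> group_center G" if z: "a \<in> group_center G" for a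
  proof -
    have a: "a \<in> carrier G" using z by (rule group_centerD)
    moreover have "inv a \<otimes> g = g \<otimes> inv a" if g: "g \<in> carrier G" for g
    proof -
      have "a \<otimes> (g \<otimes> inv a) = g"
        using group_centerD(2)[OF z g] a g by (simp add: m_assoc flip: m_assoc[of a g])
      then show ?thesis using a g by (simp add: inv_solve_left')
    qed
    ultimately show ?thesis by (simp add: group_center_def)
  qed
  show "a \<otimes> b \<in> group_center G" if "a \<in> group_center G" "b \<in> group_center G" for a b
  proof -
    have carr: "a \<in> carrier G" "b \<in> carrier G" using that by (auto intro: group_centerD)
    have "a \<otimes> b \<otimes> g = g \<otimes> (a \<otimes> b)" if g: "g \<in> carrier G" for g
    proof -
      have "a \<otimes> b \<otimes> g = a \<otimes> g \<otimes> b"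
        using carr g group_centerD(2)[OF \<open>b \<in> group_center G\<close> g] by (simp add: m_assoc)
      then show ?thesis
        using carr g group_centerD(2)[OF \<open>a \<in> group_center G\<close> g] by (simp add: m_assoc)
    qed
    then show ?thesis using carr by (simp add: group_center_def)
  qed
qed

text \<open>Elements of \<open>N\<close> commute with everything, so left and right cosets of
  \<open>N\<close> coincide. Both normality claims of the theorem are instances: the center of
  \<open>Lambda_op G H\<close> inside a larger subgroup, and a product of annihilators inside that
  center.\<close>

lemma (in group) central_subgroup_normal:
  assumes N: "subgroup N G" and S: "subgroup S G" and "N \<subseteq> S" and central: "N \<subseteq> group_center G"
  shows "N \<lhd> G\<lparr>carrier := S\<rparr>"
proof (rule normal.intro)
  show "group (G\<lparr>carrier := S\<rparr>)" using S by (rule subgroup_imp_group)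
  show "subgroup N (G\<lparr>carrier := S\<rparr>)" using N S \<open>N \<subseteq> S\<close> by (rule subgroup_incl)
  have "n \<otimes> s = s \<otimes> n" if "n \<in> N" "s \<in> S" for n s
    using that central subgroup.mem_carrier[OF S] by (auto intro: group_centerD)
  then show "normal_axioms N (G\<lparr>carrier := S\<rparr>)"
    by (auto simp: normal_axioms_def r_coset_def l_coset_def)
qed

text \<open>The identity of \<open>AutoGroup G\<close> is the identity map cut off outside the
  carrier. Extensionality of \<open>\<phi> b\<close> is what lifts pointwise agreement on the
  carrier to equality of functions.\<close>

lemma kernel_AutoGroup_iff:
  assumes "\<phi> b \<in> extensional (carrier G)"
  shows "b \<in> kernel H (AutoGroup G) \<phi> \<longleftrightarrow> b \<in> carrier H \<and> (\<forall>a \<in> carrier G. \<phi> b a = a)"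
  using assms by (auto simp: kernel_def AutoGroup_def BijGroup_def fun_eq_iff extensional_def)

section \<open>Semidirect products for an arbitrary action by automorphisms\<close>

locale aut_action = G: group G + H: group H
  for G :: "('a, 'm) monoid_scheme" (structure) and H :: "('b, 'n) monoid_scheme" +
  fixes \<phi> :: "'b \<Rightarrow> 'a \<Rightarrow> 'a"
  assumes act_hom: "\<phi> \<in> hom H (AutoGroup G)"
begin

lemma act_auto: "b \<in> carrier H \<Longrightarrow> \<phi> b \<in> auto G"
  using hom_in_carrier[OF act_hom] by (simp add: AutoGroup_def)

lemma act_in_hom: "b \<in> carrier H \<Longrightarrow> \<phi> b \<in> hom G G"
  using act_auto by (simp add: auto_def)

lemma act_closed [simp]: "\<lbrakk>b \<in> carrier H; a \<in> carrier G\<rbrakk> \<Longrightarrow> \<phi> b a \<in> carrier G"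
  using act_in_hom by (rule hom_in_carrier)

lemma act_mult [simp]:
  "\<lbrakk>b \<in> carrier H; a \<in> carrier G; c \<in> carrier G\<rbrakk> \<Longrightarrow> \<phi> b (a \<otimes> c) = \<phi> b a \<otimes> \<phi> b c"
  using act_in_hom by (rule hom_mult)

lemma act_one [simp]: "b \<in> carrier H \<Longrightarrow> \<phi> b \<one> = \<one>"
  using hom_one[OF act_in_hom] by auto

lemma act_inv [simp]: "\<lbrakk>b \<in> carrier H; a \<in> carrier G\<rbrakk> \<Longrightarrow> \<phi> b (inv a) = inv (\<phi> b a)"
  by (metis G.inv_closed G.inv_equality G.l_inv act_closed act_mult act_one)

lemma act_compose:
  assumes "b \<in> carrier H" "c \<in> carrier H" "a \<in> carrier G"
  shows "\<phi> (b \<otimes>\<^bsub>H\<^esub> c) a = \<phi> b (\<phi> c a)"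
proof -
  have "\<phi> b \<in> Bij (carrier G)" "\<phi> c \<in> Bij (carrier G)"
    using act_auto assms by (auto simp: auto_def)
  then show ?thesis
    using hom_mult[OF act_hom assms(1,2)] assms
    by (simp add: AutoGroup_def BijGroup_def compose_def)
qed

lemma act_by_one [simp]: "a \<in> carrier G \<Longrightarrow> \<phi> \<one>\<^bsub>H\<^esub> a = a"
  using hom_one[OF act_hom H.group_axioms G.AutoGroup] by (simp add: AutoGroup_def BijGroup_def)

lemma group_semidirect: "group (semidirect G H \<phi>)"
proof (rule groupI)
  show "\<exists>q\<in>carrier (semidirect G H \<phi>). q \<otimes>\<^bsub>semidirect G H \<phi>\<^esub> p = \<one>\<^bsub>semidirect G H \<phi>\<^esub>"
    if p: "p \<in> carrier (semidirect G H \<phi>)" for p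
  proof -
    obtain a b where ab: "p = (a, b)" "a \<in> carrier G" "b \<in> carrier H"
      using p by (auto simp: semidirect_def)
    show ?thesis
      \<comment> \<open>The second coordinate of a left inverse must be b^-1. The first, say c, must
        then satisfy c \<phi>_{b^-1}(a) = 1.\<close>
      by (rule bexI[of _ "(inv (\<phi> (inv\<^bsub>H\<^esub> b) a), inv\<^bsub>H\<^esub> b)"])
         (use ab in \<open>simp_all add: semidirect_def\<close>)
  qed
qed (auto simp: semidirect_def G.m_assoc H.m_assoc act_compose)

text \<open>In general the first coordinate is the inverse of \<phi>_{b^-1}(a); for a fixed point
  the twist disappears.\<close>

lemma inv_semidirect_fixed:
  assumes "a \<in> action_Fix G H \<phi>" "b \<in> carrier H"
  shows "inv\<^bsub>semidirect G H \<phi>\<^esub> (a, b) = (inv a, inv\<^bsub>H\<^esub> b)"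
  by (rule group.inv_equality[OF group_semidirect])
     (use assms in \<open>auto simp: semidirect_def action_Fix_def\<close>)

lemma subgroup_action_Fix: "subgroup (action_Fix G H \<phi>) G"
  by (rule G.subgroupI) (auto simp: action_Fix_def)

text \<open>Since every element of \<open>F\<close> is fixed, products and inverses on
  \<open>F \<times> T\<close> are coordinatewise, so closure reduces to closure of \<open>F\<close>
  and of \<open>T\<close>.\<close>

lemma subgroup_Times_semidirect:
  assumes F: "subgroup F G" and T: "subgroup T H" and fixed: "F \<subseteq> action_Fix G H \<phi>"
  shows "subgroup (F \<times> T) (semidirect G H \<phi>)"
proof (rule group.subgroupI[OF group_semidirect])
  show "F \<times> T \<subseteq> carrier (semidirect G H \<phi>)" "F \<times> T \<noteq> {}"
    using subgroup.subset[OF F] subgroup.subset[OF T] subgroup.one_closed[OF F]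
      subgroup.one_closed[OF T] by (auto simp: semidirect_def)
  show "inv\<^bsub>semidirect G H \<phi>\<^esub> p \<in> F \<times> T" if "p \<in> F \<times> T" for p
    using that fixed subgroup.mem_carrier[OF T]
    by (auto simp: inv_semidirect_fixed subset_iff subgroup.m_inv_closed[OF F]
        subgroup.m_inv_closed[OF T])
  show "p \<otimes>\<^bsub>semidirect G H \<phi>\<^esub> q \<in> F \<times> T" if "p \<in> F \<times> T" "q \<in> F \<times> T" for p q
    using that fixed subgroup.mem_carrier[OF T]
    by (auto simp: semidirect_def action_Fix_def subset_iff subgroup.m_closed[OF F]
        subgroup.m_closed[OF T])
qed

text \<open>The identity map serves as isomorphism: the twisted product s \<phi>_t(s') is just s s'
  when s' is fixed.\<close>

lemma semidirect_fixed_iso_DirProd: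
  assumes "F \<subseteq> action_Fix G H \<phi>" "T \<subseteq> carrier H"
  shows "semidirect (G\<lparr>carrier := F\<rparr>) (H\<lparr>carrier := T\<rparr>) \<phi> \<cong> G\<lparr>carrier := F\<rparr> \<times>\<times> H\<lparr>carrier := T\<rparr>"
proof (rule is_isoI)
  have "\<phi> t f = f" if "f \<in> F" "t \<in> T" for f t
    using that assms by (auto simp: action_Fix_def)
  then show "id \<in> iso (semidirect (G\<lparr>carrier := F\<rparr>) (H\<lparr>carrier := T\<rparr>) \<phi>)
      (G\<lparr>carrier := F\<rparr> \<times>\<times> H\<lparr>carrier := T\<rparr>)"
    by (auto simp: iso_def hom_def semidirect_def DirProd_def)
qed

lemma group_center_semidirect_iff:
  "(x, y) \<in> group_center (semidirect G H \<phi>) \<longleftrightarrow>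
    x \<in> action_Fix G H \<phi> \<and> y \<in> group_center H \<and> (\<forall>a \<in> carrier G. x \<otimes> \<phi> y a = a \<otimes> x)"
proof
  assume xy: "(x, y) \<in> group_center (semidirect G H \<phi>)"
  then have carr: "x \<in> carrier G" "y \<in> carrier H"
    by (auto simp: group_center_def semidirect_def)
  have comm: "x \<otimes> \<phi> y a = a \<otimes> \<phi> b x" "y \<otimes>\<^bsub>H\<^esub> b = b \<otimes>\<^bsub>H\<^esub> y"
    if "a \<in> carrier G" "b \<in> carrier H" for a b
    using group_centerD(2)[OF xy, of "(a, b)"] that by (auto simp: semidirect_def)
  show "x \<in> action_Fix G H \<phi> \<and> y \<in> group_center H \<and> (\<forall>a \<in> carrier G. x \<otimes> \<phi> y a = a \<otimes> x)"
    \<comment> \<open>Setting a = 1 gives x = \<phi>_b(x); setting b = 1 gives the twisted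
      commutation of x with a; the second coordinates give centrality of y.\<close>
    using comm(1)[of \<one>] comm(1)[of _ "\<one>\<^bsub>H\<^esub>"] comm(2)[of \<one>] carr
    by (auto simp: action_Fix_def group_center_def)
next
  assume "x \<in> action_Fix G H \<phi> \<and> y \<in> group_center H \<and> (\<forall>a \<in> carrier G. x \<otimes> \<phi> y a = a \<otimes> x)"
  then show "(x, y) \<in> group_center (semidirect G H \<phi>)"
    by (auto simp: action_Fix_def group_center_def semidirect_def)
qed

end

section \<open>The action of the circle group on the dot group in a skew left brace\<close>

context skew_left_brace
begin

lemma circ_closed [simp]:
  "\<lbrakk>a \<in> carrier G; b \<in> carrier G\<rbrakk> \<Longrightarrow> a \<otimes>\<^bsub>H\<^esub> b \<in> carrier G"
  using circ.m_closed carrier_eq by simp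

lemma circ_inv_closed [simp]: "a \<in> carrier G \<Longrightarrow> inv\<^bsub>H\<^esub> a \<in> carrier G"
  using circ.inv_closed carrier_eq by simp

lemma one_eq: "\<one>\<^bsub>H\<^esub> = \<one>"
proof -
  have carr: "\<one>\<^bsub>H\<^esub> \<in> carrier G" using circ.one_closed carrier_eq by simp
  \<comment> \<open>Compatibility at the circle identity and two dot identities: the left side
    collapses to 1, the right side to the dot inverse of the circle identity.\<close>
  have "\<one>\<^bsub>H\<^esub> \<otimes>\<^bsub>H\<^esub> (\<one> \<otimes> \<one>) = (\<one>\<^bsub>H\<^esub> \<otimes>\<^bsub>H\<^esub> \<one>) \<otimes> inv \<one>\<^bsub>H\<^esub> \<otimes> (\<one>\<^bsub>H\<^esub> \<otimes>\<^bsub>H\<^esub> \<one>)"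
    using carr by (intro brace_compat) simp_all
  then have "inv \<one>\<^bsub>H\<^esub> = \<one>"
    using carr carrier_eq by simp
  then show ?thesis using carr by (metis dot.inv_inv dot.inv_one)
qed

lemma circ_r_inv: "a \<in> carrier G \<Longrightarrow> a \<otimes>\<^bsub>H\<^esub> inv\<^bsub>H\<^esub> a = \<one>"
  using circ.r_inv carrier_eq one_eq by simp

lemma circ_one: "a \<in> carrier G \<Longrightarrow> a \<otimes>\<^bsub>H\<^esub> \<one> = a" "a \<in> carrier G \<Longrightarrow> \<one> \<otimes>\<^bsub>H\<^esub> a = a"
  using circ.r_one circ.l_one carrier_eq by (simp_all flip: one_eq)

lemma brace_lambda_op_apply:
  "b \<in> carrier G \<Longrightarrow> brace_lambda_op G H a b = (a \<otimes>\<^bsub>H\<^esub> b) \<otimes> inv a"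
  by (simp add: brace_lambda_op_def)

lemma brace_lambda_apply:
  "b \<in> carrier G \<Longrightarrow> brace_lambda G H a b = inv a \<otimes> (a \<otimes>\<^bsub>H\<^esub> b)"
  by (simp add: brace_lambda_def)

lemma brace_lambda_op_mult:
  assumes "a \<in> carrier G" "b \<in> carrier G" "c \<in> carrier G"
  shows "brace_lambda_op G H a (b \<otimes> c) = brace_lambda_op G H a b \<otimes> brace_lambda_op G H a c"
  using assms by (simp add: brace_lambda_op_apply brace_compat dot.m_assoc)

text \<open>The key is the factorization of b \<circ> c as
  \<open>brace_lambda_op G H b c \<otimes> b\<close>. Applying the multiplicative map of a to it,
  and using associativity of \<circ> on the other side, gives the claim multiplied on the right by
  \<open>brace_lambda_op G H a b\<close>, which is then cancelled.\<close>

lemma brace_lambda_op_compose: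
  assumes "a \<in> carrier G" "b \<in> carrier G" "c \<in> carrier G"
  shows "brace_lambda_op G H (a \<otimes>\<^bsub>H\<^esub> b) c = brace_lambda_op G H a (brace_lambda_op G H b c)"
proof -
  have "brace_lambda_op G H a (brace_lambda_op G H b c) \<otimes> brace_lambda_op G H a b
      = brace_lambda_op G H a (brace_lambda_op G H b c \<otimes> b)"
    using assms by (intro brace_lambda_op_mult[symmetric]) (simp_all add: brace_lambda_op_apply)
  also have "\<dots> = brace_lambda_op G H a (b \<otimes>\<^bsub>H\<^esub> c)"
    using assms by (simp add: brace_lambda_op_apply[of c b] dot.m_assoc)
  also have "\<dots> = brace_lambda_op G H (a \<otimes>\<^bsub>H\<^esub> b) c \<otimes> brace_lambda_op G H a b"
  proof -
    have "inv (a \<otimes>\<^bsub>H\<^esub> b) \<otimes> ((a \<otimes>\<^bsub>H\<^esub> b) \<otimes> inv a) = inv a"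
      using assms by (simp flip: dot.m_assoc)
    then show ?thesis
      using assms carrier_eq circ.m_assoc[of a b c]
      by (simp add: brace_lambda_op_apply dot.m_assoc)
  qed
  finally show ?thesis
    using assms by (simp add: brace_lambda_op_apply)
qed

lemma brace_lambda_op_auto:
  assumes "a \<in> carrier G"
  shows "brace_lambda_op G H a \<in> auto G"
proof -
  have closed: "brace_lambda_op G H b c \<in> carrier G" if "b \<in> carrier G" "c \<in> carrier G" for b c
    using that by (simp add: brace_lambda_op_apply)
  have one: "brace_lambda_op G H \<one> c = c" if "c \<in> carrier G" for c
    using that by (simp add: brace_lambda_op_apply circ_one)
  \<comment> \<open>The map of the circle inverse of a is a two-sided inverse, by the composition
    law and because 1 acts trivially.\<close>
  have "bij_betw (brace_lambda_op G H a) (carrier G) (carrier G)"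
  proof (rule bij_betw_byWitness[where f' = "brace_lambda_op G H (inv\<^bsub>H\<^esub> a)"])
    show "\<forall>c\<in>carrier G. brace_lambda_op G H (inv\<^bsub>H\<^esub> a) (brace_lambda_op G H a c) = c"
      using assms carrier_eq circ.l_inv[of a]
      by (simp add: one one_eq flip: brace_lambda_op_compose)
    show "\<forall>c\<in>carrier G. brace_lambda_op G H a (brace_lambda_op G H (inv\<^bsub>H\<^esub> a) c) = c"
      using assms by (simp add: circ_r_inv one flip: brace_lambda_op_compose)
  qed (use assms closed in auto)
  then show ?thesis
    using assms closed
    by (auto simp: auto_def hom_def Bij_def brace_lambda_op_mult) (simp add: brace_lambda_op_def)
qed

sublocale lambda_op: aut_action G H "brace_lambda_op G H"
proof unfold_locales
  show "brace_lambda_op G H \<in> hom H (AutoGroup G)"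
  proof (rule homI)
    show "brace_lambda_op G H a \<in> carrier (AutoGroup G)" if "a \<in> carrier H" for a
      using that carrier_eq brace_lambda_op_auto by (simp add: AutoGroup_def)
    show "brace_lambda_op G H (a \<otimes>\<^bsub>H\<^esub> b) =
        brace_lambda_op G H a \<otimes>\<^bsub>AutoGroup G\<^esub> brace_lambda_op G H b"
      if "a \<in> carrier H" "b \<in> carrier H" for a b
    proof -
      have ab: "a \<in> carrier G" "b \<in> carrier G" using that carrier_eq by auto
      \<comment> \<open>Multiplication in \<open>BijGroup\<close> is itself a restricted function,
        so it unfolds to \<open>compose\<close> only for arguments known to lie in
        \<open>Bij\<close>.\<close>
      then have "brace_lambda_op G H a \<in> Bij (carrier G)" "brace_lambda_op G H b \<in> Bij (carrier G)"
        using brace_lambda_op_auto by (auto simp: auto_def)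
      moreover have "brace_lambda_op G H (a \<otimes>\<^bsub>H\<^esub> b) =
          compose (carrier G) (brace_lambda_op G H a) (brace_lambda_op G H b)"
      proof (rule extensionalityI[where A = "carrier G"])
        show "brace_lambda_op G H (a \<otimes>\<^bsub>H\<^esub> b) \<in> extensional (carrier G)"
          by (simp add: brace_lambda_op_def)
      qed (use ab in \<open>auto simp: compose_eq brace_lambda_op_compose\<close>)
      ultimately show ?thesis by (simp add: AutoGroup_def BijGroup_def)
    qed
  qed
qed

section \<open>The center of \<open>Lambda_op G H\<close> in terms of the two products\<close>

lemma group_Lambda_op: "group (Lambda_op G H)"
  unfolding Lambda_op_def by (rule lambda_op.group_semidirect)

text \<open>The last condition is solved for y \<circ> a so that it can be compared with the
  descriptions of fixed points and kernels below, which are also equations between circle and dot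
  products.\<close>

lemma Lambda_op_center_iff:
  "(x, y) \<in> group_center (Lambda_op G H) \<longleftrightarrow>
    x \<in> action_Fix G H (brace_lambda_op G H) \<and> y \<in> group_center H \<and>
    (\<forall>a \<in> carrier G. y \<otimes>\<^bsub>H\<^esub> a = inv x \<otimes> a \<otimes> x \<otimes> y)"
proof -
  have "x \<otimes> brace_lambda_op G H y a = a \<otimes> x \<longleftrightarrow> y \<otimes>\<^bsub>H\<^esub> a = inv x \<otimes> a \<otimes> x \<otimes> y"
    if carr: "x \<in> carrier G" "y \<in> carrier G" "a \<in> carrier G" for a
  proof -
    have "x \<otimes> brace_lambda_op G H y a = a \<otimes> x \<longleftrightarrow> (y \<otimes>\<^bsub>H\<^esub> a) \<otimes> inv y = inv x \<otimes> (a \<otimes> x)"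
      using carr by (auto simp: brace_lambda_op_apply dot.inv_solve_left)
    also have "\<dots> \<longleftrightarrow> y \<otimes>\<^bsub>H\<^esub> a = inv x \<otimes> (a \<otimes> x) \<otimes> y"
      using carr by (metis circ_closed dot.inv_closed dot.inv_solve_right' dot.m_closed)
    finally show ?thesis using carr by (simp add: dot.m_assoc)
  qed
  then show ?thesis
    unfolding Lambda_op_def lambda_op.group_center_semidirect_iff
    using carrier_eq by (auto simp: action_Fix_def group_center_def)
qed

text \<open>Moving the dot inverse to the other side, here and in the next three lemmas, turns each
  condition on an action into one equation between a circle and a dot product.\<close>

lemma action_Fix_lambda_op_iff:
  "x \<in> action_Fix G H (brace_lambda_op G H) \<longleftrightarrow>
    x \<in> carrier G \<and> (\<forall>a \<in> carrier G. a \<otimes>\<^bsub>H\<^esub> x = x \<otimes> a)"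
  by (auto simp: action_Fix_def carrier_eq brace_lambda_op_apply)
     (metis circ_closed dot.inv_solve_right' dot.inv_closed)+

lemma action_Fix_lambda_iff:
  "x \<in> action_Fix G H (brace_lambda G H) \<longleftrightarrow>
    x \<in> carrier G \<and> (\<forall>a \<in> carrier G. a \<otimes>\<^bsub>H\<^esub> x = a \<otimes> x)"
  by (auto simp: action_Fix_def carrier_eq brace_lambda_apply)
     (metis circ_closed dot.inv_solve_left' dot.inv_closed)+

lemma kernel_lambda_iff:
  "y \<in> kernel H (AutoGroup G) (brace_lambda G H) \<longleftrightarrow>
    y \<in> carrier G \<and> (\<forall>a \<in> carrier G. y \<otimes>\<^bsub>H\<^esub> a = y \<otimes> a)"
proof -
  have "brace_lambda G H y \<in> extensional (carrier G)" by (simp add: brace_lambda_def)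
  from kernel_AutoGroup_iff[where \<phi> = "brace_lambda G H" and H = H, OF this] show ?thesis
    by (auto simp: carrier_eq brace_lambda_apply)
       (metis circ_closed dot.inv_solve_left' dot.inv_closed)+
qed

lemma kernel_lambda_op_iff:
  "y \<in> kernel H (AutoGroup G) (brace_lambda_op G H) \<longleftrightarrow>
    y \<in> carrier G \<and> (\<forall>a \<in> carrier G. y \<otimes>\<^bsub>H\<^esub> a = a \<otimes> y)"
proof -
  have "brace_lambda_op G H y \<in> extensional (carrier G)" by (simp add: brace_lambda_op_def)
  from kernel_AutoGroup_iff[where \<phi> = "brace_lambda_op G H" and H = H, OF this] show ?thesis
    by (auto simp: carrier_eq brace_lambda_op_apply)
       (metis circ_closed dot.inv_solve_right' dot.inv_closed)+
qed

lemma Lambda_op_center_lambda: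
  assumes xy: "(x, y) \<in> group_center (Lambda_op G H)" and a: "a \<in> carrier G"
  shows "brace_lambda G H y a = inv y \<otimes> inv x \<otimes> a \<otimes> x \<otimes> y"
    and "brace_lambda G H a y = inv a \<otimes> inv x \<otimes> a \<otimes> x \<otimes> y"
proof -
  have x: "x \<in> carrier G" and y: "y \<in> carrier G" and yH: "y \<in> group_center H"
    and eq: "y \<otimes>\<^bsub>H\<^esub> a = inv x \<otimes> a \<otimes> x \<otimes> y"
    using xy a carrier_eq group_centerD(1)[of y H]
    by (simp_all add: Lambda_op_center_iff action_Fix_def)
  \<comment> \<open>Centrality of y lets the single formula for y \<circ> a yield both identities,
    which differ only in the dot inverse placed in front.\<close>
  have "a \<otimes>\<^bsub>H\<^esub> y = y \<otimes>\<^bsub>H\<^esub> a"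
    using group_centerD(2)[OF yH] a carrier_eq by simp
  then show "brace_lambda G H y a = inv y \<otimes> inv x \<otimes> a \<otimes> x \<otimes> y"
    and "brace_lambda G H a y = inv a \<otimes> inv x \<otimes> a \<otimes> x \<otimes> y"
    using x y a eq by (simp_all add: brace_lambda_apply dot.m_assoc)
qed

text \<open>For y = 1 the criterion says a = x^-1 a x, so x is central in \<open>G\<close>. Then a
  \<circ> x = x a and a \<circ> x = a x are the same condition, and the fixed points of the two
  actions agree on such x.\<close>

lemma Lambda_op_center_fst_iff:
  assumes x: "x \<in> carrier G"
  shows "(x, \<one>\<^bsub>H\<^esub>) \<in> group_center (Lambda_op G H) \<longleftrightarrow>
    x \<in> group_center G \<inter> action_Fix G H (brace_lambda G H)"
proof -
  have "\<one>\<^bsub>H\<^esub> \<in> group_center H"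
    by (simp add: group_center_def)
  moreover have "a = inv x \<otimes> a \<otimes> x \<longleftrightarrow> x \<otimes> a = a \<otimes> x" if "a \<in> carrier G" for a
    using x that by (auto simp: dot.m_assoc dot.inv_solve_left)
  ultimately have "(x, \<one>\<^bsub>H\<^esub>) \<in> group_center (Lambda_op G H) \<longleftrightarrow>
      (\<forall>a \<in> carrier G. a \<otimes>\<^bsub>H\<^esub> x = x \<otimes> a) \<and> (\<forall>a \<in> carrier G. x \<otimes> a = a \<otimes> x)"
    using x by (simp add: Lambda_op_center_iff action_Fix_lambda_op_iff one_eq circ_one)
  then show ?thesis
    using x by (simp add: action_Fix_lambda_iff group_center_def) metis
qed

text \<open>For x = 1 the criterion says y \<circ> a = a y, which is the kernel condition.
  Centrality in \<open>H\<close> turns it into a \<circ> y = a y, so y is fixed under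
  \<lambda>.\<close>

lemma Lambda_op_center_snd_iff:
  assumes y: "y \<in> carrier G"
  shows "(\<one>, y) \<in> group_center (Lambda_op G H) \<longleftrightarrow>
    y \<in> group_center H \<inter> action_Fix G H (brace_lambda G H)
        \<inter> kernel H (AutoGroup G) (brace_lambda_op G H)"
proof -
  have "(\<one>, y) \<in> group_center (Lambda_op G H) \<longleftrightarrow>
      y \<in> group_center H \<and> (\<forall>a \<in> carrier G. y \<otimes>\<^bsub>H\<^esub> a = a \<otimes> y)"
    using y by (simp add: Lambda_op_center_iff action_Fix_lambda_op_iff circ_one)
  then show ?thesis
    using y carrier_eq group_centerD(2)[of y H]
    by (simp add: action_Fix_lambda_iff kernel_lambda_op_iff) metis
qed

section \<open>The annihilator, on which the two group structures agree\<close>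

lemma brace_Ann_iff:
  "x \<in> brace_Ann G H \<longleftrightarrow>
    x \<in> carrier G \<and> (\<forall>a \<in> carrier G. x \<otimes>\<^bsub>H\<^esub> a = x \<otimes> a \<and> a \<otimes>\<^bsub>H\<^esub> x = x \<otimes> a \<and> a \<otimes> x = x \<otimes> a)"
  \<comment> \<open>The kernel condition equates x \<circ> a with x a, and the two centralities
    exchange the factors, so all four products of x and a coincide.\<close>
  by (simp add: brace_Ann_def kernel_lambda_iff group_center_def carrier_eq) metis

lemma brace_Ann_circ: "\<lbrakk>x \<in> brace_Ann G H; a \<in> carrier G\<rbrakk> \<Longrightarrow> x \<otimes>\<^bsub>H\<^esub> a = x \<otimes> a"
  by (simp add: brace_Ann_iff)

lemma brace_Ann_subset_Fix: "brace_Ann G H \<subseteq> action_Fix G H (brace_lambda_op G H)"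
  by (auto simp: brace_Ann_iff action_Fix_lambda_op_iff)

lemma inv_eq_of_Ann:
  assumes "x \<in> brace_Ann G H"
  shows "inv\<^bsub>H\<^esub> x = inv x"
proof -
  have "inv x \<otimes>\<^bsub>H\<^esub> x = \<one>\<^bsub>H\<^esub>"
    using assms by (simp add: brace_Ann_iff one_eq)
  then show ?thesis
    using assms by (intro circ.inv_equality) (auto simp: brace_Ann_iff carrier_eq)
qed

text \<open>Both versions are required since the first factor of \<open>Lambda_op G H\<close>
  carries the dot product and the second the circle product. Products and inverses in the two groups
  agree on the annihilator, so one closure argument serves both.\<close>

lemma subgroup_brace_Ann: "subgroup (brace_Ann G H) G" "subgroup (brace_Ann G H) H"
proof -
  have mult: "x \<otimes> y \<in> brace_Ann G H" "x \<otimes>\<^bsub>H\<^esub> y = x \<otimes> y"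
    if x: "x \<in> brace_Ann G H" and y: "y \<in> brace_Ann G H" for x y
  proof -
    have carr: "x \<in> carrier G" "y \<in> carrier G" using x y by (auto simp: brace_Ann_iff)
    then show eq: "x \<otimes>\<^bsub>H\<^esub> y = x \<otimes> y"
      using x by (simp add: brace_Ann_iff)
    have "x \<otimes>\<^bsub>H\<^esub> y \<in> group_center H"
      using x y by (intro subgroup.m_closed[OF circ.subgroup_group_center]) (auto simp: brace_Ann_def)
    moreover have "x \<otimes> y \<in> group_center G"
      using x y by (intro subgroup.m_closed[OF dot.subgroup_group_center]) (auto simp: brace_Ann_def)
    moreover have "(x \<otimes>\<^bsub>H\<^esub> y) \<otimes>\<^bsub>H\<^esub> a = x \<otimes> y \<otimes> a" if "a \<in> carrier G" for a
    proof -
      have "(x \<otimes>\<^bsub>H\<^esub> y) \<otimes>\<^bsub>H\<^esub> a = x \<otimes>\<^bsub>H\<^esub> (y \<otimes>\<^bsub>H\<^esub> a)"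
        using carr that carrier_eq by (intro circ.m_assoc) simp_all
      then show ?thesis
        using carr that by (simp add: dot.m_assoc brace_Ann_circ[OF x] brace_Ann_circ[OF y])
    qed
    ultimately show "x \<otimes> y \<in> brace_Ann G H"
      using carr eq by (simp add: brace_Ann_def kernel_lambda_iff)
  qed
  have inv: "inv x \<in> brace_Ann G H" if x: "x \<in> brace_Ann G H" for x
  proof -
    have carr: "x \<in> carrier G" using x by (simp add: brace_Ann_iff)
    have "inv\<^bsub>H\<^esub> x \<in> group_center H"
      using x by (intro subgroup.m_inv_closed[OF circ.subgroup_group_center]) (auto simp: brace_Ann_def)
    moreover have "inv x \<in> group_center G"
      using x by (intro subgroup.m_inv_closed[OF dot.subgroup_group_center]) (auto simp: brace_Ann_def)
    moreover have "inv\<^bsub>H\<^esub> x \<otimes>\<^bsub>H\<^esub> a = inv x \<otimes> a" if a: "a \<in> carrier G" for a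
    proof -
      \<comment> \<open>Circle multiplication by x sends x^-1 a to a; solving for x^-1 a shows that
        the circle inverse of x also acts by dot multiplication.\<close>
      have "x \<otimes>\<^bsub>H\<^esub> (inv x \<otimes> a) = x \<otimes> (inv x \<otimes> a)"
        using x a carr by (simp add: brace_Ann_circ)
      also have "\<dots> = a"
        using a carr by (simp flip: dot.m_assoc)
      finally show ?thesis
        using a carr carrier_eq circ.inv_solve_left[of "inv x \<otimes> a" x a] by simp
    qed
    ultimately show ?thesis
      using carr inv_eq_of_Ann[OF x] by (simp add: brace_Ann_def kernel_lambda_iff)
  qed
  have one: "\<one> \<in> brace_Ann G H" by (simp add: brace_Ann_iff circ_one)
  have sub: "brace_Ann G H \<subseteq> carrier G" by (auto simp: brace_Ann_iff)
  show "subgroup (brace_Ann G H) G"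
    using mult(1) inv one sub by (auto intro!: dot.subgroupI)
  show "subgroup (brace_Ann G H) H"
    using mult inv one sub carrier_eq by (auto intro!: circ.subgroupI simp: inv_eq_of_Ann)
qed

text \<open>Conjugation by the dot-central x is trivial, so the criterion reduces to y \<circ> a = a
  y, which holds for y in the annihilator.\<close>

lemma brace_Ann_subset_center:
  "brace_Ann G H \<times> brace_Ann G H \<subseteq> group_center (Lambda_op G H)"
proof
  fix p assume "p \<in> brace_Ann G H \<times> brace_Ann G H"
  then obtain x y where p: "p = (x, y)" and x: "x \<in> brace_Ann G H" and y: "y \<in> brace_Ann G H"
    by blast
  have carr: "x \<in> carrier G" "y \<in> carrier G" using x y by (auto simp: brace_Ann_iff)
  have "y \<otimes>\<^bsub>H\<^esub> a = inv x \<otimes> a \<otimes> x \<otimes> y" if "a \<in> carrier G" for a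
  proof -
    have "a \<otimes> x = x \<otimes> a" "a \<otimes> y = y \<otimes> a"
      using x y that by (simp_all add: brace_Ann_iff)
    then have "inv x \<otimes> a \<otimes> x \<otimes> y = y \<otimes> a"
      using carr that by (simp add: dot.m_assoc dot.inv_solve_left')
    then show ?thesis using y that by (simp add: brace_Ann_circ)
  qed
  then show "p \<in> group_center (Lambda_op G H)"
    using x y p brace_Ann_subset_Fix by (auto simp: Lambda_op_center_iff brace_Ann_def)
qed

end

theorem proposition3p4:
  fixes G :: "('a, 'm) monoid_scheme" and H :: "('a, 'n) monoid_scheme"
  assumes "skew_left_brace G H"
  shows
    "(subgroup (action_Fix G H (brace_lambda_op G H) \<times> group_center H) (Lambda_op G H)
      \<and> group_center (Lambda_op G H) \<lhd>
          semidirect (G\<lparr>carrier := action_Fix G H (brace_lambda_op G H)\<rparr>)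
            (H\<lparr>carrier := group_center H\<rparr>) (brace_lambda_op G H)
      \<and> semidirect (G\<lparr>carrier := action_Fix G H (brace_lambda_op G H)\<rparr>)
            (H\<lparr>carrier := group_center H\<rparr>) (brace_lambda_op G H)
          \<cong> G\<lparr>carrier := action_Fix G H (brace_lambda_op G H)\<rparr> \<times>\<times> H\<lparr>carrier := group_center H\<rparr>)
    \<and> (\<forall>x y. (x, y) \<in> group_center (Lambda_op G H) \<longrightarrow>
      (\<forall>a \<in> carrier G.
        brace_lambda G H y a = inv\<^bsub>G\<^esub> y \<otimes>\<^bsub>G\<^esub> inv\<^bsub>G\<^esub> x \<otimes>\<^bsub>G\<^esub> a \<otimes>\<^bsub>G\<^esub> x \<otimes>\<^bsub>G\<^esub> y
        \<and> brace_lambda G H a y = inv\<^bsub>G\<^esub> a \<otimes>\<^bsub>G\<^esub> inv\<^bsub>G\<^esub> x \<otimes>\<^bsub>G\<^esub> a \<otimes>\<^bsub>G\<^esub> x \<otimes>\<^bsub>G\<^esub> y))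
    \<and> (\<forall>x \<in> carrier G. (x, \<one>\<^bsub>H\<^esub>) \<in> group_center (Lambda_op G H) \<longleftrightarrow>
      x \<in> group_center G \<inter> action_Fix G H (brace_lambda G H))
    \<and> (\<forall>y \<in> carrier G. (\<one>\<^bsub>G\<^esub>, y) \<in> group_center (Lambda_op G H) \<longleftrightarrow>
      y \<in> group_center H \<inter> action_Fix G H (brace_lambda G H)
          \<inter> kernel H (AutoGroup G) (brace_lambda_op G H))
    \<and> (brace_Ann G H \<times> brace_Ann G H \<lhd>
      (Lambda_op G H)\<lparr>carrier := group_center (Lambda_op G H)\<rparr>)"
proof -
  interpret skew_left_brace G H by fact
  let ?F = "action_Fix G H (brace_lambda_op G H)" and ?C = "group_center (Lambda_op G H)"
  have FZ: "subgroup (?F \<times> group_center H) (Lambda_op G H)"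
    unfolding Lambda_op_def
    by (intro lambda_op.subgroup_Times_semidirect lambda_op.subgroup_action_Fix
        circ.subgroup_group_center subset_refl)
  have C: "subgroup ?C (Lambda_op G H)"
    by (rule group.subgroup_group_center[OF group_Lambda_op])
  have "?C \<subseteq> ?F \<times> group_center H"
    by (auto simp: Lambda_op_center_iff)
  \<comment> \<open>By \<open>semidirect_restrict_carrier\<close> the semidirect product of the
    restricted groups is \<open>Lambda_op G H\<close> with a smaller carrier, so the lemma on
    central subgroups applies.\<close>
  then have "?C \<lhd> semidirect (G\<lparr>carrier := ?F\<rparr>) (H\<lparr>carrier := group_center H\<rparr>)
      (brace_lambda_op G H)"
    using group.central_subgroup_normal[OF group_Lambda_op C FZ]
    by (simp add: semidirect_restrict_carrier Lambda_op_def)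
  moreover have "semidirect (G\<lparr>carrier := ?F\<rparr>) (H\<lparr>carrier := group_center H\<rparr>)
      (brace_lambda_op G H) \<cong> G\<lparr>carrier := ?F\<rparr> \<times>\<times> H\<lparr>carrier := group_center H\<rparr>"
    by (rule lambda_op.semidirect_fixed_iso_DirProd) (auto intro: group_centerD)
  \<comment> \<open>Annihilator elements are fixed by the action, which makes the product set a
    subgroup of \<open>Lambda_op G H\<close>; it is normal in the center because it is
    central.\<close>
  moreover have "brace_Ann G H \<times> brace_Ann G H \<lhd> (Lambda_op G H)\<lparr>carrier := ?C\<rparr>"
    using group.central_subgroup_normal[OF group_Lambda_op _ C] brace_Ann_subset_center
      lambda_op.subgroup_Times_semidirect[OF subgroup_brace_Ann brace_Ann_subset_Fix]
    by (simp add: Lambda_op_def)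
  ultimately show ?thesis
    using FZ Lambda_op_center_lambda Lambda_op_center_fst_iff Lambda_op_center_snd_iff
    by (intro conjI allI ballI impI)
qed

end
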